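(* Let $r\in\mathbb{N}$ (so $r\ge 1$) and $0<\pi\le 1$, let $\chi$ be the Negative Binomial$(r,\pi)$ distribution, i.e. $\chi(m)=\binom{m+r-1}{r-1}(1-\pi)^m\pi^r$ for $m\in\mathbb{N}_0$, and let $(p,q)\in[0,1]^2$ with $0<p+q<1$. The probability that the bond percolation game with parameter-pair $(p,q)$, played on the rooted Galton-Watson tree $T_\chi$ starting from its root, results in a draw is $0$ if and only if $$(r-1)^{r+1}(1-\pi)(1-p-q)\pi^{r}\le (q+\pi-q\pi)^{r+1}r^{r}.$$
   Context: Here $\pi$ is a parameter (not the circle constant). $\mathbb{N}_0=\{0,1,2,\dots\}$, and $0^0=1$. $T_\chi$ is the rooted Galton-Watson tree with root $\phi$ in which the numbers of children of the vertices are i.i.d. with law $\chi$. Each edge $\{u,v\}$ ($u$ the parent of $v$) is directed from $u$ to $v$. Bond percolation game with parameter-pair $(p,q)$: given $T_\chi$, each edge is independently labeled trap with probability $p$, target with probability $q$, safe with probability $1-p-q$. The tree and all labels are revealed to both players (perfect information). Two players alternately move a token, initially at $\phi$; a move takes the token from its current vertex $u$ along a directed edge to a child of $u$. A player who moves the token along a target edge wins immediately; a player who moves it along a trap edge loses immediately; a player whose turn it is to move when the token is at a leaf (childless vertex) loses. If the game continues forever it is a draw. Both players play optimally: for a given realization, the game is won (respectively lost) by the first player if the first (respectively second) player has a strategy guaranteeing a win for herself in finitely many rounds against any play of the opponent; otherwise the game results in a draw. *)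

theory Defs
  imports "HOL-Probability.Probability"
begin

datatype edge_label = Trap | Target | Safe

text \<open>
  Ulam-Harris encoding: a vertex is the list of child indices leading to it from the root
  \<open>[]\<close>, so the children of \<open>v\<close> are \<open>v @ [0], v @ [1], \<dots>\<close>. A realization \<open>\<omega>\<close> attaches to every
  conceivable vertex \<open>v\<close> the number of children of \<open>v\<close> and the label of the edge that enters
  \<open>v\<close> from its parent (for the root this label has no meaning and is never consulted).
\<close>

type_synonym vertex = "nat list"
type_synonym realization = "vertex \<Rightarrow> nat \<times> edge_label"

definition num_children :: "realization \<Rightarrow> vertex \<Rightarrow> nat" where
  "num_children \<omega> v = fst (\<omega> v)"

definition label_into :: "realization \<Rightarrow> vertex \<Rightarrow> edge_label" where
  "label_into \<omega> v = snd (\<omega> v)"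

definition tree :: "realization \<Rightarrow> vertex set" where
  "tree \<omega> = {v. \<forall>i < length v. v ! i < num_children \<omega> (take i v)}"

text \<open>
  A strategy names the index of the child to move to. As a vertex determines the path from the
  root, it determines the whole history of the game and also, by its depth, whose turn it is.
  A strategy depends on the realization, since it is quantified after \<open>\<omega>\<close> (perfect information).
\<close>

type_synonym strategy = "vertex \<Rightarrow> nat"

definition legal_strategy :: "realization \<Rightarrow> strategy \<Rightarrow> bool" where
  "legal_strategy \<omega> \<sigma> \<longleftrightarrow> (\<forall>v \<in> tree \<omega>. num_children \<omega> v > 0 \<longrightarrow> \<sigma> v < num_children \<omega> v)"

text \<open>
  Position of the token after \<open>n\<close> moves, where the first player follows \<open>\<sigma>\<close> and moves at even
  times and the second player follows \<open>\<tau>\<close> and moves at odd times. It is meaningful only as long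
  as the game has not ended, which \<open>still_running\<close> keeps track of.
\<close>

primrec token :: "strategy \<Rightarrow> strategy \<Rightarrow> nat \<Rightarrow> vertex" where
  "token \<sigma> \<tau> 0 = []"
| "token \<sigma> \<tau> (Suc n) = token \<sigma> \<tau> n @ [(if even n then \<sigma> else \<tau>) (token \<sigma> \<tau> n)]"

definition still_running :: "realization \<Rightarrow> strategy \<Rightarrow> strategy \<Rightarrow> nat \<Rightarrow> bool" where
  "still_running \<omega> \<sigma> \<tau> n \<longleftrightarrow>
     (\<forall>k < n. num_children \<omega> (token \<sigma> \<tau> k) > 0 \<and> label_into \<omega> (token \<sigma> \<tau> (Suc k)) = Safe)"

definition mover_wins_at :: "realization \<Rightarrow> strategy \<Rightarrow> strategy \<Rightarrow> nat \<Rightarrow> bool" where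
  "mover_wins_at \<omega> \<sigma> \<tau> n \<longleftrightarrow> still_running \<omega> \<sigma> \<tau> n \<and>
     num_children \<omega> (token \<sigma> \<tau> n) > 0 \<and> label_into \<omega> (token \<sigma> \<tau> (Suc n)) = Target"

definition mover_loses_at :: "realization \<Rightarrow> strategy \<Rightarrow> strategy \<Rightarrow> nat \<Rightarrow> bool" where
  "mover_loses_at \<omega> \<sigma> \<tau> n \<longleftrightarrow> still_running \<omega> \<sigma> \<tau> n \<and>
     (num_children \<omega> (token \<sigma> \<tau> n) = 0 \<or> label_into \<omega> (token \<sigma> \<tau> (Suc n)) = Trap)"

definition first_wins_play :: "realization \<Rightarrow> strategy \<Rightarrow> strategy \<Rightarrow> bool" where
  "first_wins_play \<omega> \<sigma> \<tau> \<longleftrightarrow>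
     (\<exists>n. (even n \<and> mover_wins_at \<omega> \<sigma> \<tau> n) \<or> (odd n \<and> mover_loses_at \<omega> \<sigma> \<tau> n))"

definition second_wins_play :: "realization \<Rightarrow> strategy \<Rightarrow> strategy \<Rightarrow> bool" where
  "second_wins_play \<omega> \<sigma> \<tau> \<longleftrightarrow>
     (\<exists>n. (odd n \<and> mover_wins_at \<omega> \<sigma> \<tau> n) \<or> (even n \<and> mover_loses_at \<omega> \<sigma> \<tau> n))"

definition game_won :: "realization \<Rightarrow> bool" where
  "game_won \<omega> \<longleftrightarrow>
     (\<exists>\<sigma>. legal_strategy \<omega> \<sigma> \<and> (\<forall>\<tau>. legal_strategy \<omega> \<tau> \<longrightarrow> first_wins_play \<omega> \<sigma> \<tau>))"

definition game_lost :: "realization \<Rightarrow> bool" where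
  "game_lost \<omega> \<longleftrightarrow>
     (\<exists>\<tau>. legal_strategy \<omega> \<tau> \<and> (\<forall>\<sigma>. legal_strategy \<omega> \<sigma> \<longrightarrow> second_wins_play \<omega> \<sigma> \<tau>))"

definition game_drawn :: "realization \<Rightarrow> bool" where
  "game_drawn \<omega> \<longleftrightarrow> \<not> game_won \<omega> \<and> \<not> game_lost \<omega>"

definition edge_label_pmf :: "real \<Rightarrow> real \<Rightarrow> edge_label pmf" where
  "edge_label_pmf p q = pmf_of_list [(Trap, p), (Target, q), (Safe, 1 - p - q)]"

text \<open>
  Numbers of children and labels are drawn independently for all conceivable vertices, whether
  or not they belong to the tree. The restriction to \<open>tree \<omega>\<close> then is a Galton-Watson tree with
  offspring law \<open>offspring\<close> and, given the tree, i.i.d. edge labels.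
\<close>

definition percolation_game_measure :: "nat pmf \<Rightarrow> real \<Rightarrow> real \<Rightarrow> realization measure" where
  "percolation_game_measure offspring p q =
     (\<Pi>\<^sub>M v\<in>(UNIV :: vertex set). measure_pmf (pair_pmf offspring (edge_label_pmf p q)))"

definition draw_probability :: "nat pmf \<Rightarrow> real \<Rightarrow> real \<Rightarrow> real" where
  "draw_probability offspring p q =
     measure (percolation_game_measure offspring p q)
       {\<omega> \<in> space (percolation_game_measure offspring p q). game_drawn \<omega>}"

lemma pmf_edge_label_pmf:
  assumes "0 \<le> p" "0 \<le> q" "p + q \<le> 1"
  shows "pmf (edge_label_pmf p q) Trap = p"
    and "pmf (edge_label_pmf p q) Target = q"
    and "pmf (edge_label_pmf p q) Safe = 1 - p - q"
proof -
  have "pmf_of_list_wf [(Trap, p), (Target, q), (Safe, 1 - p - q)]"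
    using assms by (auto simp: pmf_of_list_wf_def)
  then show "pmf (edge_label_pmf p q) Trap = p" "pmf (edge_label_pmf p q) Target = q"
    "pmf (edge_label_pmf p q) Safe = 1 - p - q"
    by (simp_all add: edge_label_pmf_def pmf_pmf_of_list)
qed

text \<open>
  The library's \<open>neg_binomial_pmf r \<pi>\<close> counts failures before the \<open>r\<close>-th success, \<open>\<pi>\<close> being the
  probability of success.
\<close>

lemma pmf_neg_binomial':
  assumes "1 \<le> r" "0 < \<pi>" "\<pi> \<le> 1"
  shows "pmf (neg_binomial_pmf r \<pi>) m =
    real ((m + r - 1) choose (r - 1)) * (1 - \<pi>) ^ m * \<pi> ^ r"
proof -
  have "(m + r - 1) choose m = (m + r - 1) choose (r - 1)"
    using assms(1) binomial_symmetric[of m "m + r - 1"] by simp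
  then show ?thesis
    using assms by (simp add: pmf_neg_binomial)
qed

end

theory Submission
  imports Defs
begin

text \<open>
  Let \<open>w\<^sub>n\<close> and \<open>1 - b\<^sub>n\<close> be the probabilities that the first player wins, respectively loses,
  within \<open>n\<close> moves. The tree is locally finite, so a won game is won within a bounded number of
  moves, and the draw probability is the limit of \<open>b\<^sub>n - w\<^sub>n\<close>. Independence of the subtrees gives
  \<open>w\<^sub>n\<^sub>+\<^sub>1 = F b\<^sub>n\<close> and \<open>b\<^sub>n\<^sub>+\<^sub>1 = F w\<^sub>n\<close> with \<open>F x = 1 - G (p + s x)\<close>, where \<open>s = 1 - p - q\<close> and \<open>G\<close> is
  the generating function of the offspring law. In the coordinate \<open>1 - (1 - \<pi>) (p + s x)\<close> the map
  \<open>F\<close> becomes \<open>H y = A + K / y ^ r\<close> with \<open>A = q + \<pi> - q \<pi>\<close> and \<open>K = (1 - \<pi>) s \<pi> ^ r\<close>, and a draw has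
  probability 0 iff the two limits, which form a 2-cycle of \<open>H\<close>, coincide. The stated inequality
  says that the fixed point of \<open>H\<close> has multiplier at least \<open>-1\<close>. If it fails, the fixed point repels
  \<open>H \<circ> H\<close> and the limits stay apart. A 2-cycle \<open>{y, t y}\<close> with \<open>t > 1\<close> forces
  \<open>K = A ^ (r + 1) [r] ^ r / (t [r - 1] ^ (r + 1))\<close> with \<open>[n] = 1 + t + \<dots> + t ^ (n - 1)\<close>, and
  log-convexity of the suitably normalized \<open>[n]\<close> shows that the inequality then fails.
\<close>

section \<open>Two-cycles of \<open>y \<mapsto> A + K / y ^ r\<close>\<close>

text \<open>AM-GM: the exponents \<open>2 * i\<close> lie symmetrically about \<open>n - 1\<close>,
  and two terms at equal nonzero distance from it add up to more than
  \<open>2 * u ^ (n - 1)\<close>. The induction in steps of two peels off the outermost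
  pair.\<close>

lemma geometric_sum_gt_midpoint:
  fixes u :: real
  assumes "1 < u" and "2 \<le> n"
  shows "real n * u ^ (n - 1) < (\<Sum>i<n. (u\<^sup>2) ^ i)"
proof -
  have base: "real (Suc (Suc m)) * u ^ Suc m < (\<Sum>i<Suc (Suc m). (u\<^sup>2) ^ i)" for m
  proof (induction m rule: induct_nat_012)
    case 0
    have "0 < (u - 1)\<^sup>2" using assms(1) by simp
    then show ?case by (simp add: power2_eq_square algebra_simps)
  next
    case 1
    have "1 < u\<^sup>2" using assms(1) by (simp add: one_less_power)
    then have "0 < (u\<^sup>2 - 1)\<^sup>2" by simp
    then show ?case by (simp add: power2_eq_square algebra_simps power_numeral_reduce)
  next
    case (ge2 m)
    have "0 < (u ^ Suc (Suc (Suc m)) - 1)\<^sup>2" using assms(1)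
      by (metis diff_gt_0_iff_gt one_less_power zero_less_Suc zero_less_power)
    then have "2 * u ^ Suc (Suc (Suc m)) < 1 + (u\<^sup>2) ^ Suc (Suc (Suc m))"
      by (simp add: power2_eq_square algebra_simps power_mult_distrib)
    moreover have "(\<Sum>i<Suc (Suc (Suc (Suc m))). (u\<^sup>2) ^ i)
        = 1 + u\<^sup>2 * (\<Sum>i<Suc (Suc m). (u\<^sup>2) ^ i) + (u\<^sup>2) ^ Suc (Suc (Suc m))"
      by (subst sum.lessThan_Suc, subst sum.lessThan_Suc_shift) (simp add: sum_distrib_left del: sum.lessThan_Suc)
    moreover have "u\<^sup>2 * (real (Suc (Suc m)) * u ^ Suc m) < u\<^sup>2 * (\<Sum>i<Suc (Suc m). (u\<^sup>2) ^ i)"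
      using ge2.IH(1) assms(1) by (intro mult_strict_left_mono) auto
    moreover have "u\<^sup>2 * (real (Suc (Suc m)) * u ^ Suc m) + 2 * u ^ Suc (Suc (Suc m))
        = real (Suc (Suc (Suc (Suc m)))) * u ^ Suc (Suc (Suc m))"
      by (simp add: power2_eq_square algebra_simps)
    ultimately show ?case by linarith
  qed
  obtain m where "n = Suc (Suc m)"
    using assms(2) by (metis Suc_le_D numeral_2_eq_2 Suc_le_mono)
  then show ?thesis using base[of m] by simp
qed

text \<open>The preceding bound at \<open>u = sqrt t\<close>, squared to remove the half-integer
  exponent \<open>(n - 1) / 2\<close> of \<open>t\<close>.\<close>

lemma geometric_sum_square_gt:
  fixes t :: real
  assumes "1 < t" and "2 \<le> n"
  shows "(real n)\<^sup>2 * t ^ (n - 1) < (\<Sum>i<n. t ^ i)\<^sup>2"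
proof -
  have "1 < sqrt t" and sq: "(sqrt t)\<^sup>2 = t" using assms(1) by auto
  from geometric_sum_gt_midpoint[OF this(1) assms(2)]
  have "real n * sqrt t ^ (n - 1) < (\<Sum>i<n. t ^ i)" by (simp add: sq)
  then have "(real n * sqrt t ^ (n - 1))\<^sup>2 < (\<Sum>i<n. t ^ i)\<^sup>2"
    using assms(1) by (intro power_strict_mono) auto
  moreover have "(sqrt t ^ (n - 1))\<^sup>2 = t ^ (n - 1)"
    by (metis power_mult mult.commute sq)
  ultimately show ?thesis by (simp add: power_mult_distrib)
qed

text \<open>A Cassini-type identity. Its defect \<open>t ^ n\<close> is the quantity that the
  preceding bound controls in the convexity proof.\<close>

lemma geometric_sum_square_eq:
  fixes t :: real
  shows "(\<Sum>i<Suc n. t ^ i)\<^sup>2 = (\<Sum>i<n. t ^ i) * (\<Sum>i<Suc (Suc n). t ^ i) + t ^ n"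
proof -
  let ?S = "\<Sum>i<n. t ^ i"
  have "?S + t ^ n = 1 + t * ?S"
    using sum.lessThan_Suc_shift[of "(^) t" n] by (simp add: sum_distrib_left)
  then have "t ^ n * (?S + t ^ n) = t ^ n * (1 + t * ?S)" by simp
  then show ?thesis by (simp add: power2_eq_square algebra_simps)
qed

text \<open>
  With \<open>t = exp (2 * \<theta>)\<close>, this is \<open>\<phi> n = ln (sinh (n * \<theta>) / (n * sinh \<theta>))\<close>, so that its
  convexity in \<open>n\<close> is that of \<open>ln (sinh x / x)\<close>.
\<close>

definition log_normalized_sum :: "real \<Rightarrow> nat \<Rightarrow> real" where
  "log_normalized_sum t n = ln ((\<Sum>i<n. t ^ i) / real n) - (real n - 1) / 2 * ln t"

lemma log_normalized_sum_pos:
  assumes "1 < t" and "2 \<le> n"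
  shows "0 < log_normalized_sum t n"
proof -
  have S: "0 < (\<Sum>i<n. t ^ i)" using assms by (intro sum_pos) (auto simp: lessThan_empty_iff)
  have "ln ((real n)\<^sup>2 * t ^ (n - 1)) < ln ((\<Sum>i<n. t ^ i)\<^sup>2)"
    using geometric_sum_square_gt[OF assms] assms S by (subst ln_less_cancel_iff) auto
  then have "2 * ln (real n) + (real n - 1) * ln t < 2 * ln (\<Sum>i<n. t ^ i)"
    using assms S by (simp add: ln_mult ln_realpow of_nat_diff)
  then show ?thesis using assms S by (simp add: log_normalized_sum_def ln_div field_simps)
qed

text \<open>The terms linear in \<open>n\<close> cancel, and after exponentiation the claim compares
  \<open>S (n + 1)\<close> squared times \<open>n * (n + 2)\<close> with
  \<open>(n + 1)\<^sup>2 * S n * S (n + 2)\<close>. Since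
  \<open>n * (n + 2) = (n + 1)\<^sup>2 - 1\<close>, the Cassini-type identity reduces it to the
  square bound at \<open>n + 1\<close>.\<close>

lemma log_normalized_sum_convex:
  assumes "1 < t" and "1 \<le> n"
  shows "2 * log_normalized_sum t (Suc n) \<le> log_normalized_sum t n + log_normalized_sum t (Suc (Suc n))"
proof -
  define S where "S k = (\<Sum>i<k. t ^ i)" for k
  have S: "0 < S k" if "1 \<le> k" for k
    using assms that unfolding S_def by (intro sum_pos) (auto simp: lessThan_empty_iff)
  have id: "(S (Suc n))\<^sup>2 = S n * S (Suc (Suc n)) + t ^ n"
    unfolding S_def by (rule geometric_sum_square_eq)
  have "(real (Suc n))\<^sup>2 * t ^ n < (S (Suc n))\<^sup>2"
    using geometric_sum_square_gt[of t "Suc n"] assms unfolding S_def by simp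
  then have "(real (Suc n))\<^sup>2 * t ^ n \<le> S n * S (Suc (Suc n)) + t ^ n" using id by simp
  then have "(S n * S (Suc (Suc n)) + t ^ n) * ((real (Suc n))\<^sup>2 - 1)
      \<le> (real (Suc n))\<^sup>2 * (S n * S (Suc (Suc n)))"
    by (simp only: right_diff_distrib mult.commute[of "(real (Suc n))\<^sup>2"] distrib_right)
  moreover have "(real n * real (Suc (Suc n))) = (real (Suc n))\<^sup>2 - 1"
    by (simp add: power2_eq_square algebra_simps)
  ultimately have "(S (Suc n))\<^sup>2 * (real n * real (Suc (Suc n)))
      \<le> (real (Suc n))\<^sup>2 * (S n * S (Suc (Suc n)))"
    using id by simp
  then have "ln ((S (Suc n))\<^sup>2 * (real n * real (Suc (Suc n))))
      \<le> ln ((real (Suc n))\<^sup>2 * (S n * S (Suc (Suc n))))"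
    using S[of n] S[of "Suc n"] S[of "Suc (Suc n)"] assms by (subst ln_le_cancel_iff) auto
  moreover have "S n > 0" "S (Suc n) > 0" "S (Suc (Suc n)) > 0" using S assms by auto
  ultimately have "2 * ln (S (Suc n)) + (ln (real n) + ln (real (Suc (Suc n))))
      \<le> 2 * ln (real (Suc n)) + (ln (S n) + ln (S (Suc (Suc n))))"
    using assms by (simp add: ln_mult ln_realpow del: of_nat_Suc)
  then show ?thesis
    using \<open>S n > 0\<close> \<open>S (Suc n) > 0\<close> \<open>S (Suc (Suc n)) > 0\<close> assms
    unfolding log_normalized_sum_def S_def[symmetric]
    by (simp add: ln_div field_simps)
qed

text \<open>The function vanishes at 1, so by convexity its chords from there have nondecreasing
  slopes: \<open>\<phi> n / (n - 1) \<le> \<phi> (n + 1) / n\<close>, here cleared of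
  denominators.\<close>

lemma log_normalized_sum_superlinear:
  assumes "1 < t" and "1 \<le> n"
  shows "real n * log_normalized_sum t n \<le> (real n - 1) * log_normalized_sum t (Suc n)"
  using assms(2)
proof (induction n rule: dec_induct)
  case base
  then show ?case by (simp add: log_normalized_sum_def)
next
  case (step n)
  have "real n * (2 * log_normalized_sum t (Suc n))
      \<le> real n * (log_normalized_sum t n + log_normalized_sum t (Suc (Suc n)))"
    using log_normalized_sum_convex[OF assms(1) step(1)] by (intro mult_left_mono) auto
  then show ?case using step.IH by (simp add: algebra_simps)
qed

text \<open>In logarithms the claim is \<open>(r + 1) * \<phi> (r - 1) < r * \<phi> r\<close>. The
  lone factor \<open>t\<close> comes from the normalization, because
  \<open>r * (r - 1) / 2 - (r + 1) * (r - 2) / 2 = 1\<close>.\<close>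

lemma geometric_sum_power_gt:
  fixes t :: real
  assumes "1 < t" and "2 \<le> r"
  shows "real r ^ r * (t * (\<Sum>i<r - 1. t ^ i) ^ (r + 1)) < (real r - 1) ^ (r + 1) * (\<Sum>i<r. t ^ i) ^ r"
proof -
  let ?\<phi> = "log_normalized_sum t"
  obtain n where r: "r = Suc n" and n: "1 \<le> n"
    using assms(2) by (cases r) auto
  have "0 < (\<Sum>i<k. t ^ i)" if "1 \<le> k" for k
    using assms that by (intro sum_pos) (auto simp: lessThan_empty_iff)
  from this[of n] this[of r] have pos: "0 < (\<Sum>i<n. t ^ i)" "0 < (\<Sum>i<r. t ^ i)"
    using n r by auto
  have "(real r + 1) * ?\<phi> n < real r * ?\<phi> r"
  proof (cases "n = 1")
    case True
    then show ?thesis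
      using log_normalized_sum_pos[OF assms] assms(2) by (simp add: log_normalized_sum_def)
  next
    case False
    then have "0 < ?\<phi> n" using log_normalized_sum_pos[OF assms(1), of n] n by simp
    moreover have "real r * (real n * ?\<phi> n) \<le> real r * ((real n - 1) * ?\<phi> r)"
      using log_normalized_sum_superlinear[OF assms(1) n] r by (intro mult_left_mono) auto
    \<comment> \<open>Strictness comes from \<open>(r - 2) * (r + 1) = r * (r - 1) - 2\<close> and
      \<open>?\<phi> n > 0\<close>. The factor \<open>n - 1 = r - 2\<close> can be cancelled only
      for \<open>n > 1\<close>, hence the separate case above.\<close>
    ultimately have "(real n - 1) * ((real r + 1) * ?\<phi> n) < (real n - 1) * (real r * ?\<phi> r)"
      using r by (simp add: algebra_simps)
    then show ?thesis using False n by (simp add: mult_less_cancel_left)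
  qed
  then have "real r * ln (real r) + (ln t + (real r + 1) * ln (\<Sum>i<n. t ^ i))
      < (real r + 1) * ln (real n) + real r * ln (\<Sum>i<r. t ^ i)"
    using pos n r unfolding log_normalized_sum_def by (simp add: ln_div field_simps)
  then have "ln (real r ^ r * (t * (\<Sum>i<n. t ^ i) ^ (r + 1)))
      < ln (real n ^ (r + 1) * (\<Sum>i<r. t ^ i) ^ r)"
    using pos n r assms(1) by (simp add: ln_mult ln_realpow del: power_Suc sum.lessThan_Suc)
  then have "real r ^ r * (t * (\<Sum>i<n. t ^ i) ^ (r + 1)) < real n ^ (r + 1) * (\<Sum>i<r. t ^ i) ^ r"
    using pos n r assms by (subst (asm) ln_less_cancel_iff) auto
  then show ?thesis using r by simp
qed

section \<open>Absence of two-cycles\<close>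

text \<open>The ratio \<open>t = z / y\<close> parametrizes the cycle: the two equations determine
  \<open>y\<close> and \<open>K\<close> from \<open>A\<close> and \<open>t\<close>. Inserting this
  value of \<open>K\<close> turns the claim into \<open>geometric_sum_power_gt\<close>.\<close>

lemma no_two_cycle_aux:
  fixes A K y z :: real
  assumes "1 \<le> r" and "0 < A" and "0 < y" and "y < z"
    and y: "y = A + K / z ^ r" and z: "z = A + K / y ^ r"
  shows "A ^ (r + 1) * real r ^ r < (real r - 1) ^ (r + 1) * K"
proof -
  have e1: "y * z ^ r = A * z ^ r + K" and e2: "z * y ^ r = A * y ^ r + K"
    using assms(3,4) by (subst y, simp add: field_simps, subst z, simp add: field_simps)
  \<comment> \<open>For \<open>r = 1\<close> both equations have the left side \<open>y * z\<close>,
    so their difference excludes a proper cycle. From here on the sum \<open>S (r - 1)\<close> is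
    nonempty.\<close>
  have r: "2 \<le> r"
  proof (rule ccontr)
    assume "\<not> 2 \<le> r"
    then have "r = 1" using assms(1) by simp
    then have "A * (z - y) = 0" using e1 e2 by (simp add: algebra_simps)
    then show False using assms(2,4) by simp
  qed
  define t where "t = z / y"
  define S where "S k = (\<Sum>i<k. t ^ i)" for k
  have t: "1 < t" and zt: "z = t * y" using assms(3,4) by (auto simp: t_def)
  have S: "t ^ k - 1 = (t - 1) * S k" for k
    unfolding S_def by (rule power_diff_1_eq)
  obtain n where n: "r = Suc n" using r by (cases r) auto
  have "0 < S n" unfolding S_def using t n r by (intro sum_pos) (auto simp: lessThan_empty_iff)
  \<comment> \<open>This is the difference of \<open>e1\<close> and \<open>e2\<close>, in which
    \<open>K\<close> cancels; dividing by \<open>t - 1\<close> then leaves geometric sums.\<close>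
  have "y ^ r * (y * (t * (t ^ n - 1))) = y ^ r * (A * (t ^ r - 1))"
    using e1 e2 unfolding zt n by (simp add: power_mult_distrib algebra_simps)
  then have "y * (t * (t ^ n - 1)) = A * (t ^ r - 1)" using assms(3) by simp
  then have "(t - 1) * (y * t * S n) = (t - 1) * (A * S r)" unfolding S by (simp add: algebra_simps)
  then have yt: "y * t * S n = A * S r" using t by simp
  have Sr: "S r = S n + t ^ n" unfolding S_def n by simp
  have "K = y ^ r * (t * y - A)" using e2 unfolding zt by (simp add: algebra_simps)
  then have "K * S n = y ^ r * (y * t * S n - A * S n)" by (simp only:) (simp add: algebra_simps)
  also have "\<dots> = A * y ^ r * t ^ n" unfolding yt Sr by (simp add: algebra_simps)
  \<comment> \<open>The factor \<open>t * S n ^ r\<close> is chosen so that \<open>y\<close> occurs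
    only in the product \<open>y * t * S n\<close>, which \<open>yt\<close> eliminates.\<close>
  finally have "K * S n * (t * S n ^ r) = A * (y * t * S n) ^ r"
    unfolding n by (simp add: power_mult_distrib algebra_simps)
  then have K: "K * (t * S n ^ (r + 1)) = A ^ (r + 1) * S r ^ r"
    unfolding yt by (simp add: power_mult_distrib algebra_simps)
  have "A ^ (r + 1) * (real r ^ r * (t * S n ^ (r + 1))) < A ^ (r + 1) * ((real r - 1) ^ (r + 1) * S r ^ r)"
    using geometric_sum_power_gt[OF t r] assms(2) n unfolding S_def
    by (intro mult_strict_left_mono) auto
  also have "\<dots> = (real r - 1) ^ (r + 1) * (K * (t * S n ^ (r + 1)))"
    unfolding K by simp
  finally have "(A ^ (r + 1) * real r ^ r) * (t * S n ^ (r + 1)) < ((real r - 1) ^ (r + 1) * K) * (t * S n ^ (r + 1))"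
    by (simp only: mult.assoc)
  then show ?thesis using t \<open>0 < S n\<close> by (simp add: mult_less_cancel_right)
qed

lemma no_two_cycle:
  fixes A K y z :: real
  assumes "1 \<le> r" and "0 < A" and "0 < y" and "0 < z"
    and "y = A + K / z ^ r" and "z = A + K / y ^ r"
    and "(real r - 1) ^ (r + 1) * K \<le> A ^ (r + 1) * real r ^ r"
  shows "y = z"
proof (rule linorder_cases[of y z])
  assume "y < z"
  from no_two_cycle_aux[OF assms(1,2,3) this assms(5,6)] assms(7) show ?thesis by simp
next
  assume "z < y"
  from no_two_cycle_aux[OF assms(1,2,4) this assms(6,5)] assms(7) show ?thesis by simp
qed

text \<open>The strict inequality says that the derivative of \<open>x \<mapsto> A + K / x ^ r\<close> at \<open>y\<close> is below \<open>-1\<close>, so that the second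
  iterate crosses the diagonal from below there.\<close>

lemma repelling_fixed_point:
  fixes A K y :: real
  assumes "1 \<le> r" and "0 < A" and "0 < K" and "0 < y" and y: "y = A + K / y ^ r"
    and K: "A ^ (r + 1) * real r ^ r < (real r - 1) ^ (r + 1) * K"
  shows "\<exists>x. A \<le> x \<and> x < y \<and> A + K / (A + K / x ^ r) ^ r < x"
proof -
  have Ke: "K = (y - A) * y ^ r" using y assms(4) by (simp add: field_simps)
  have "A < y" using y assms(3,4) by (smt (verit) divide_pos_pos zero_less_power)
  \<comment> \<open>As \<open>K = (y - A) * y ^ r\<close>, this says that the multiplier is below
    -1. Otherwise \<open>(r - 1) * y \<le> r * A\<close>, which bounds both factors of
    \<open>(r - 1) ^ (r + 1) * K\<close> and contradicts the hypothesis on \<open>K\<close>.\<close>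
  have big: "y < real r * (y - A)"
  proof (rule ccontr)
    assume "\<not> ?thesis"
    then have le: "(real r - 1) * y \<le> real r * A" by (simp add: algebra_simps)
    have r1: "0 \<le> (real r - 1) * y" using assms(1,4) by simp
    have "c ^ (r + 1) * K = (c * y - c * A) * (c * y) ^ r" for c
      unfolding Ke by (simp add: power_mult_distrib algebra_simps)
    then have "(real r - 1) ^ (r + 1) * K = ((real r - 1) * y - (real r - 1) * A) * ((real r - 1) * y) ^ r"
      .
    also have "\<dots> \<le> (real r * A - (real r - 1) * A) * (real r * A) ^ r"
      by (rule mult_mono[OF _ power_mono]; insert le r1 assms(2); simp add: left_diff_distrib)
    also have "\<dots> = A ^ (r + 1) * real r ^ r" by (simp add: power_mult_distrib algebra_simps)
    finally show False using K by simp
  qed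
  define D where "D = - real r * K / y ^ (r + 1)"
  have "D = - (real r * (y - A) / y)" unfolding D_def Ke using assms(4) by simp
  moreover have "1 < real r * (y - A) / y" using big assms(4) by (simp add: pos_less_divide_eq)
  ultimately have "D < -1" by simp
  then have D2: "0 < D * D - 1"
    using mult_strict_mono'[of 1 "- D" 1 "- D"] by simp
  define H where "H x = A + K / x ^ r" for x
  have Hy: "H y = y" using y unfolding H_def by simp
  have dH: "(H has_real_derivative D) (at y)"
  proof -
    obtain m where m: "r = Suc m" using assms(1) by (cases r) auto
    have "(H has_real_derivative 0 + (0 * y ^ r - K * (real r * (1 * y ^ (r - 1)))) / (y ^ r * y ^ r)) (at y)"
      unfolding H_def using assms(4) by (intro derivative_intros DERIV_power) auto
    moreover have "0 + (0 * y ^ r - K * (real r * (1 * y ^ (r - 1)))) / (y ^ r * y ^ r) = D"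
      unfolding D_def m using assms(4) by (simp add: divide_simps) (simp add: algebra_simps)
    ultimately show ?thesis by (simp only:)
  qed
  have "((\<lambda>x. H (H x)) has_real_derivative D * D) (at y)"
    by (rule DERIV_chain2[of H, unfolded Hy]) (use dH Hy in simp_all)
  then have "((\<lambda>x. H (H x) - x) has_real_derivative (D * D - 1)) (at y)"
    by (auto intro!: derivative_eq_intros)
  from DERIV_pos_inc_left[OF this D2] obtain d where d: "d > 0"
    and dec: "\<And>h. 0 < h \<Longrightarrow> h < d \<Longrightarrow> H (H (y - h)) - (y - h) < H (H y) - y" by blast
  \<comment> \<open>The bound \<open>d / 2\<close> keeps \<open>h\<close> where \<open>dec\<close>
    applies, and \<open>y - A\<close> keeps \<open>y - h\<close> from falling below
    \<open>A\<close>.\<close>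
  define h where "h = min (d / 2) (y - A)"
  have "0 < h" "h < d" "A \<le> y - h" using d \<open>A < y\<close> by (auto simp: h_def min_def)
  then show ?thesis using dec[of h] Hy unfolding H_def by (intro exI[of _ "y - h"]) auto
qed

section \<open>Limits of the alternating iteration\<close>

text \<open>By continuity the limits satisfy the two-cycle equations, so the inequality forces them
  to agree. If it fails, a common limit would be a repelling fixed point, and a point
  \<open>x\<close> below it bounds the even terms of \<open>z\<close> away from it.\<close>

lemma alternating_iteration_limits_eq_iff:
  fixes A K :: real and y z :: "nat \<Rightarrow> real"
  assumes r: "1 \<le> r" and A: "0 < A" and K: "0 \<le> K"
    and y_Suc: "\<And>n. y (Suc n) = A + K / z n ^ r" and z_Suc: "\<And>n. z (Suc n) = A + K / y n ^ r"
    and z0: "z 0 = A" and y_ge: "\<And>n. A \<le> y n" and z_ge: "\<And>n. A \<le> z n"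
    and Y: "y \<longlonglongrightarrow> Y" and Z: "z \<longlonglongrightarrow> Z"
  shows "Y = Z \<longleftrightarrow> (real r - 1) ^ (r + 1) * K \<le> A ^ (r + 1) * real r ^ r"
proof -
  have "A \<le> Y" "A \<le> Z" using LIMSEQ_le_const[OF Y] LIMSEQ_le_const[OF Z] y_ge z_ge by auto
  then have pos: "0 < Y" "0 < Z" using A by auto
  have Y_eq: "Y = A + K / Z ^ r"
  proof (rule LIMSEQ_unique[OF LIMSEQ_Suc[OF Y]])
    show "(\<lambda>n. y (Suc n)) \<longlonglongrightarrow> A + K / Z ^ r"
      unfolding y_Suc using pos by (intro tendsto_intros Z) auto
  qed
  have Z_eq: "Z = A + K / Y ^ r"
  proof (rule LIMSEQ_unique[OF LIMSEQ_Suc[OF Z]])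
    show "(\<lambda>n. z (Suc n)) \<longlonglongrightarrow> A + K / Y ^ r"
      unfolding z_Suc using pos by (intro tendsto_intros Y) auto
  qed
  show ?thesis
  proof
    assume "(real r - 1) ^ (r + 1) * K \<le> A ^ (r + 1) * real r ^ r"
    then show "Y = Z" by (rule no_two_cycle[OF r A pos Y_eq Z_eq])
  next
    assume YZ: "Y = Z"
    show "(real r - 1) ^ (r + 1) * K \<le> A ^ (r + 1) * real r ^ r"
    proof (rule ccontr)
      assume "\<not> ?thesis"
      then have less: "A ^ (r + 1) * real r ^ r < (real r - 1) ^ (r + 1) * K" by simp
      moreover have "0 < A ^ (r + 1) * real r ^ r" using A r by simp
      ultimately have "K \<noteq> 0" by auto
      then have "0 < K" using K by simp
      from repelling_fixed_point[OF r A this pos(2) Z_eq[unfolded YZ] less] obtain x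
        where x: "A \<le> x" "x < Z" "A + K / (A + K / x ^ r) ^ r < x" by blast
      \<comment> \<open>The map is decreasing, so its second iterate is increasing; it sends
        \<open>x\<close> below \<open>x\<close>, and the orbit starts at
        \<open>A \<le> x\<close>.\<close>
      have "z (2 * n) \<le> x" for n
      proof (induction n)
        case 0
        then show ?case using z0 x(1) by simp
      next
        case (Suc n)
        have "A + K / x ^ r \<le> y (Suc (2 * n))"
          unfolding y_Suc using Suc z_ge[of "2 * n"] A K
          by (intro add_left_mono divide_left_mono power_mono) auto
        moreover have "0 < A + K / x ^ r" using A K x(1) by (simp add: add_pos_nonneg)
        ultimately have "z (Suc (Suc (2 * n))) \<le> A + K / (A + K / x ^ r) ^ r"
          unfolding z_Suc[of "Suc (2 * n)"] using K
          by (intro add_left_mono divide_left_mono power_mono) auto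
        then show ?case using x(3) by simp
      qed
      moreover have "(\<lambda>n. z (2 * n)) \<longlonglongrightarrow> Z"
        using LIMSEQ_subseq_LIMSEQ[OF Z, of "\<lambda>n. 2 * n"] by (simp add: strict_mono_def comp_def)
      ultimately have "Z \<le> x" by (intro LIMSEQ_le_const2[of "\<lambda>n. z (2 * n)"]) auto
      then show False using x(2) by simp
    qed
  qed
qed

section \<open>Determinacy at a finite stage\<close>

text \<open>A recursion without strategies, from the view of the player about to move. A leaf is
  lost from stage 1 on, by the empty quantifier; stage 0 decides nothing.\<close>

fun wins_within :: "nat \<Rightarrow> realization \<Rightarrow> bool"
  and loses_within :: "nat \<Rightarrow> realization \<Rightarrow> bool" where
  "wins_within 0 \<omega> = False"
| "loses_within 0 \<omega> = False"
| "wins_within (Suc n) \<omega> = (\<exists>i < fst (\<omega> []). snd (\<omega> [i]) = Target \<or>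
     snd (\<omega> [i]) = Safe \<and> loses_within n (\<lambda>v. \<omega> (i # v)))"
| "loses_within (Suc n) \<omega> = (\<forall>i < fst (\<omega> []). snd (\<omega> [i]) = Trap \<or>
     snd (\<omega> [i]) = Safe \<and> wins_within n (\<lambda>v. \<omega> (i # v)))"

lemma within_Suc_mono:
  "(wins_within n \<omega> \<longrightarrow> wins_within (Suc n) \<omega>) \<and> (loses_within n \<omega> \<longrightarrow> loses_within (Suc n) \<omega>)"
proof (induction n arbitrary: \<omega>)
  case (Suc n)
  then show ?case
    unfolding wins_within.simps(2)[of "Suc n"] wins_within.simps(2)[of n]
      loses_within.simps(2)[of "Suc n"] loses_within.simps(2)[of n]
    by blast
qed simp

lemma wins_within_mono: "m \<le> n \<Longrightarrow> wins_within m \<omega> \<Longrightarrow> wins_within n \<omega>"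
  by (induction n rule: dec_induct) (use within_Suc_mono in blast)+

lemma loses_within_mono: "m \<le> n \<Longrightarrow> loses_within m \<omega> \<Longrightarrow> loses_within n \<omega>"
  by (induction n rule: dec_induct) (use within_Suc_mono in blast)+

lemma not_wins_and_loses_within: "\<not> (wins_within n \<omega> \<and> loses_within n \<omega>)"
  by (induction n arbitrary: \<omega>) auto

definition won_at :: "realization \<Rightarrow> vertex \<Rightarrow> bool" where
  "won_at \<omega> v \<longleftrightarrow> (\<exists>n. wins_within n (\<lambda>u. \<omega> (v @ u)))"

definition lost_at :: "realization \<Rightarrow> vertex \<Rightarrow> bool" where
  "lost_at \<omega> v \<longleftrightarrow> (\<exists>n. loses_within n (\<lambda>u. \<omega> (v @ u)))"

lemma wins_within_Suc_at:
  "wins_within (Suc n) (\<lambda>u. \<omega> (v @ u)) \<longleftrightarrow> (\<exists>i < num_children \<omega> v. label_into \<omega> (v @ [i]) = Target \<or>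
     label_into \<omega> (v @ [i]) = Safe \<and> loses_within n (\<lambda>u. \<omega> ((v @ [i]) @ u)))"
  by (simp add: num_children_def label_into_def)

lemma loses_within_Suc_at:
  "loses_within (Suc n) (\<lambda>u. \<omega> (v @ u)) \<longleftrightarrow> (\<forall>i < num_children \<omega> v. label_into \<omega> (v @ [i]) = Trap \<or>
     label_into \<omega> (v @ [i]) = Safe \<and> wins_within n (\<lambda>u. \<omega> ((v @ [i]) @ u)))"
  by (simp add: num_children_def label_into_def)

lemma won_atI:
  assumes "i < num_children \<omega> v"
    and "label_into \<omega> (v @ [i]) = Target \<or> label_into \<omega> (v @ [i]) = Safe \<and> lost_at \<omega> (v @ [i])"
  shows "won_at \<omega> v"
proof -
  obtain n where "label_into \<omega> (v @ [i]) = Target \<or>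
      label_into \<omega> (v @ [i]) = Safe \<and> loses_within n (\<lambda>u. \<omega> ((v @ [i]) @ u))"
    using assms(2) unfolding lost_at_def by blast
  then have "wins_within (Suc n) (\<lambda>u. \<omega> (v @ u))"
    unfolding wins_within_Suc_at using assms(1) by blast
  then show ?thesis unfolding won_at_def by blast
qed

text \<open>Finitely many stages suffice at every vertex because the tree is locally finite.\<close>

lemma lost_atI:
  assumes "\<And>i. i < num_children \<omega> v \<Longrightarrow>
    label_into \<omega> (v @ [i]) = Trap \<or> label_into \<omega> (v @ [i]) = Safe \<and> won_at \<omega> (v @ [i])"
  shows "lost_at \<omega> v"
proof -
  have "\<forall>i. \<exists>n. i < num_children \<omega> v \<longrightarrow> label_into \<omega> (v @ [i]) = Trap \<or>
      label_into \<omega> (v @ [i]) = Safe \<and> wins_within n (\<lambda>u. \<omega> ((v @ [i]) @ u))"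
    using assms unfolding won_at_def by blast
  then obtain f where f: "\<And>i. i < num_children \<omega> v \<Longrightarrow> label_into \<omega> (v @ [i]) = Trap \<or>
      label_into \<omega> (v @ [i]) = Safe \<and> wins_within (f i) (\<lambda>u. \<omega> ((v @ [i]) @ u))"
    by metis
  \<comment> \<open>The sum is a common bound for the finitely many stages and also makes sense at a
    leaf.\<close>
  define n where "n = (\<Sum>i<num_children \<omega> v. f i)"
  have "f i \<le> n" if "i < num_children \<omega> v" for i
    unfolding n_def using that member_le_sum[of i "{..<num_children \<omega> v}" f] by simp
  then have "loses_within (Suc n) (\<lambda>u. \<omega> (v @ u))"
    unfolding loses_within_Suc_at using f wins_within_mono[of "f i" n for i] by metis
  then show ?thesis unfolding lost_at_def by blast
qed

lemma snoc_mem_tree: "v @ [i] \<in> tree \<omega> \<longleftrightarrow> v \<in> tree \<omega> \<and> i < num_children \<omega> v"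
  by (auto simp: tree_def nth_append less_Suc_eq)

text \<open>Legality restricts a strategy only on the tree, so the token has to be known to stay
  there before a move of the opponent can be bounded.\<close>

lemma token_mem_tree:
  assumes "legal_strategy \<omega> \<sigma>" and "legal_strategy \<omega> \<tau>" and "still_running \<omega> \<sigma> \<tau> k"
  shows "token \<sigma> \<tau> k \<in> tree \<omega>"
  using assms(3)
proof (induction k)
  case 0
  then show ?case by (simp add: tree_def)
next
  case (Suc k)
  then have "token \<sigma> \<tau> k \<in> tree \<omega>" "0 < num_children \<omega> (token \<sigma> \<tau> k)"
    by (auto simp: still_running_def)
  then show ?case using assms(1,2) by (auto simp: snoc_mem_tree legal_strategy_def)
qed

lemma still_running_Suc:
  "still_running \<omega> \<sigma> \<tau> (Suc k) \<longleftrightarrow> still_running \<omega> \<sigma> \<tau> k \<and> 0 < num_children \<omega> (token \<sigma> \<tau> k) \<and>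
     label_into \<omega> (token \<sigma> \<tau> (Suc k)) = Safe"
  unfolding still_running_def All_less_Suc by blast

text \<open>The flag \<open>b\<close> selects a player: \<open>True\<close> is the first player, who moves at even times.\<close>

definition player :: "strategy \<Rightarrow> strategy \<Rightarrow> bool \<Rightarrow> strategy" where
  "player \<sigma> \<tau> b = (if b then \<sigma> else \<tau>)"

definition player_wins_play :: "realization \<Rightarrow> strategy \<Rightarrow> strategy \<Rightarrow> bool \<Rightarrow> bool" where
  "player_wins_play \<omega> \<sigma> \<tau> b \<longleftrightarrow>
     (\<exists>n. (even n = b \<and> mover_wins_at \<omega> \<sigma> \<tau> n) \<or> (even n \<noteq> b \<and> mover_loses_at \<omega> \<sigma> \<tau> n))"

lemma player_wins_play_simps:
  "player_wins_play \<omega> \<sigma> \<tau> True = first_wins_play \<omega> \<sigma> \<tau>"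
  "player_wins_play \<omega> \<sigma> \<tau> False = second_wins_play \<omega> \<sigma> \<tau>"
  by (simp_all add: player_wins_play_def first_wins_play_def second_wins_play_def)

lemma token_Suc_player:
  "token \<sigma> \<tau> (Suc k) = token \<sigma> \<tau> k @ [player \<sigma> \<tau> (even k) (token \<sigma> \<tau> k)]"
  by (simp add: player_def)

section \<open>Strategies that force a win\<close>

text \<open>The strict drop \<open>m < n\<close> of the stage matters: moving merely to some lost
  child could prolong the game forever. At a vertex that is not won, any child qualifies.\<close>

definition winning_move :: "realization \<Rightarrow> vertex \<Rightarrow> nat \<Rightarrow> bool" where
  "winning_move \<omega> v i \<longleftrightarrow> i < num_children \<omega> v \<and>
     (\<forall>n. wins_within n (\<lambda>u. \<omega> (v @ u)) \<longrightarrow> label_into \<omega> (v @ [i]) = Target \<or>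
       label_into \<omega> (v @ [i]) = Safe \<and> (\<exists>m<n. loses_within m (\<lambda>u. \<omega> ((v @ [i]) @ u))))"

text \<open>A single move serves all stages if it is taken from the least stage \<open>Suc m\<close>
  at which \<open>v\<close> is won, because \<open>m\<close> is then below every such stage.\<close>

lemma winning_move_exists:
  assumes "0 < num_children \<omega> v"
  shows "\<exists>i. winning_move \<omega> v i"
proof (cases "won_at \<omega> v")
  case False
  then show ?thesis using assms by (auto simp: winning_move_def won_at_def)
next
  case True
  define n where "n = (LEAST n. wins_within n (\<lambda>u. \<omega> (v @ u)))"
  have n: "wins_within n (\<lambda>u. \<omega> (v @ u))"
    using True unfolding won_at_def n_def by (rule LeastI_ex)
  then obtain m where m: "n = Suc m" by (cases n) auto
  have "wins_within (Suc m) (\<lambda>u. \<omega> (v @ u))" using n m by simp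
  then obtain i where i: "i < num_children \<omega> v" "label_into \<omega> (v @ [i]) = Target \<or>
     label_into \<omega> (v @ [i]) = Safe \<and> loses_within m (\<lambda>u. \<omega> ((v @ [i]) @ u))"
    unfolding wins_within_Suc_at by metis
  have least: "m < n'" if "wins_within n' (\<lambda>u. \<omega> (v @ u))" for n'
    using Least_le[of "\<lambda>n. wins_within n (\<lambda>u. \<omega> (v @ u))", OF that] m unfolding n_def by simp
  show ?thesis
    unfolding winning_move_def using i least by (intro exI[of _ i] conjI allI impI) metis+
qed

text \<open>Induction on the stage, which drops with every move: by \<open>winning_move\<close> on
  the turns of player \<open>b\<close>, and by the recursion on the opponent's turns. The condition
  \<open>even k = b\<close> says that player \<open>b\<close> moves at time
  \<open>k\<close>.\<close>

lemma winning_strategy: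
  assumes legal: "legal_strategy \<omega> \<sigma>" "legal_strategy \<omega> \<tau>"
    and move: "\<And>v. 0 < num_children \<omega> v \<Longrightarrow> winning_move \<omega> v (player \<sigma> \<tau> b v)"
    and "still_running \<omega> \<sigma> \<tau> k"
    and "if even k = b then wins_within n (\<lambda>u. \<omega> (token \<sigma> \<tau> k @ u))
         else loses_within n (\<lambda>u. \<omega> (token \<sigma> \<tau> k @ u))"
  shows "player_wins_play \<omega> \<sigma> \<tau> b"
  using assms(4,5)
proof (induction n arbitrary: k rule: less_induct)
  case (less n)
  let ?v = "token \<sigma> \<tau> k"
  obtain m where n: "n = Suc m" using less.prems(2) by (cases n) (auto split: if_splits)
  show ?case
  proof (cases "even k = b")
    case True
    then have w: "wins_within n (\<lambda>u. \<omega> (?v @ u))" using less.prems(2) by simp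
    then have nc: "0 < num_children \<omega> ?v" unfolding n wins_within_Suc_at by auto
    have "label_into \<omega> (token \<sigma> \<tau> (Suc k)) = Target \<or> label_into \<omega> (token \<sigma> \<tau> (Suc k)) = Safe \<and>
        (\<exists>m<n. loses_within m (\<lambda>u. \<omega> (token \<sigma> \<tau> (Suc k) @ u)))"
      using move[OF nc] w True unfolding winning_move_def token_Suc_player by blast
    then show ?thesis
    proof (elim disjE conjE exE)
      assume "label_into \<omega> (token \<sigma> \<tau> (Suc k)) = Target"
      then show ?thesis using less.prems(1) nc True
        unfolding player_wins_play_def mover_wins_at_def by blast
    next
      fix m assume "label_into \<omega> (token \<sigma> \<tau> (Suc k)) = Safe" "m < n"
        "loses_within m (\<lambda>u. \<omega> (token \<sigma> \<tau> (Suc k) @ u))"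
      then show ?thesis
        using less.IH[of m "Suc k"] less.prems(1) nc True by (auto simp: still_running_Suc)
    qed
  next
    case False
    then have l: "loses_within n (\<lambda>u. \<omega> (?v @ u))" using less.prems(2) by simp
    show ?thesis
    proof (cases "num_children \<omega> ?v = 0")
      case True
      then show ?thesis using less.prems(1) False
        unfolding player_wins_play_def mover_loses_at_def by blast
    next
      case nc: False
      have "?v \<in> tree \<omega>" using token_mem_tree[OF legal less.prems(1)] .
      then have "player \<sigma> \<tau> (even k) ?v < num_children \<omega> ?v"
        using legal nc by (auto simp: legal_strategy_def player_def)
      then have "label_into \<omega> (token \<sigma> \<tau> (Suc k)) = Trap \<or> label_into \<omega> (token \<sigma> \<tau> (Suc k)) = Safe \<and>
          wins_within m (\<lambda>u. \<omega> (token \<sigma> \<tau> (Suc k) @ u))"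
        using l unfolding n loses_within_Suc_at token_Suc_player by blast
      then show ?thesis
      proof (elim disjE conjE)
        assume "label_into \<omega> (token \<sigma> \<tau> (Suc k)) = Trap"
        then show ?thesis using less.prems(1) False
          unfolding player_wins_play_def mover_loses_at_def by blast
      next
        assume "label_into \<omega> (token \<sigma> \<tau> (Suc k)) = Safe"
          "wins_within m (\<lambda>u. \<omega> (token \<sigma> \<tau> (Suc k) @ u))"
        then show ?thesis
          using less.IH[of m "Suc k"] less.prems(1) nc False n by (auto simp: still_running_Suc)
      qed
    qed
  qed
qed

section \<open>Strategies that avoid defeat\<close>

text \<open>The defensive counterpart of \<open>winning_move\<close>. No stage appears, since
  avoiding defeat requires no progress.\<close>

definition safe_move :: "realization \<Rightarrow> vertex \<Rightarrow> nat \<Rightarrow> bool" where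
  "safe_move \<omega> v i \<longleftrightarrow> i < num_children \<omega> v \<and>
     (\<not> lost_at \<omega> v \<longrightarrow> label_into \<omega> (v @ [i]) = Target \<or>
       label_into \<omega> (v @ [i]) = Safe \<and> \<not> won_at \<omega> (v @ [i]))"

text \<open>The contrapositive of \<open>lost_atI\<close>, so finite branching enters here.\<close>

lemma safe_move_exists:
  assumes "0 < num_children \<omega> v"
  shows "\<exists>i. safe_move \<omega> v i"
proof (cases "lost_at \<omega> v")
  case True
  then show ?thesis using assms by (auto simp: safe_move_def)
next
  case False
  then obtain i where "i < num_children \<omega> v" "label_into \<omega> (v @ [i]) \<noteq> Trap"
    "\<not> (label_into \<omega> (v @ [i]) = Safe \<and> won_at \<omega> (v @ [i]))"
    using lost_atI[of \<omega> v] by blast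
  moreover have "x = Target \<or> x = Safe" if "x \<noteq> Trap" for x using that by (cases x) auto
  ultimately show ?thesis unfolding safe_move_def by blast
qed

text \<open>Moves of player \<open>b\<close> preserve the invariant by \<open>safe_move\<close>.
  Moves of the opponent preserve it by \<open>won_atI\<close>: a safe edge from a vertex that is not
  won cannot lead to a lost one.\<close>

lemma safe_strategy_invariant:
  assumes legal: "legal_strategy \<omega> \<sigma>" "legal_strategy \<omega> \<tau>"
    and move: "\<And>v. 0 < num_children \<omega> v \<Longrightarrow> safe_move \<omega> v (player \<sigma> \<tau> b v)"
    and root: "if b then \<not> lost_at \<omega> [] else \<not> won_at \<omega> []"
    and "still_running \<omega> \<sigma> \<tau> k"
  shows "if even k = b then \<not> lost_at \<omega> (token \<sigma> \<tau> k) else \<not> won_at \<omega> (token \<sigma> \<tau> k)"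
  using assms(5)
proof (induction k)
  case 0
  then show ?case using root by auto
next
  case (Suc k)
  let ?v = "token \<sigma> \<tau> k"
  have run: "still_running \<omega> \<sigma> \<tau> k" and nc: "0 < num_children \<omega> ?v"
    and safe: "label_into \<omega> (token \<sigma> \<tau> (Suc k)) = Safe"
    using Suc.prems by (auto simp only: still_running_Suc)
  show ?case
  proof (cases "even k = b")
    case True
    then have "\<not> lost_at \<omega> ?v" using Suc.IH[OF run] by simp
    then have "\<not> won_at \<omega> (token \<sigma> \<tau> (Suc k))"
      using move[OF nc] safe True unfolding safe_move_def token_Suc_player by auto
    then show ?thesis using True by simp
  next
    case False
    then have "\<not> won_at \<omega> ?v" using Suc.IH[OF run] by simp
    moreover have "player \<sigma> \<tau> (even k) ?v < num_children \<omega> ?v"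
      using token_mem_tree[OF legal run] legal nc by (auto simp: legal_strategy_def player_def)
    ultimately have "\<not> lost_at \<omega> (token \<sigma> \<tau> (Suc k))"
      using won_atI[of _ \<omega> ?v] safe unfolding token_Suc_player by blast
    then show ?thesis using False by simp
  qed
qed

text \<open>Either way for the opponent to win breaks the invariant: a target edge makes her vertex
  won, while a leaf or a trap on the turn of \<open>b\<close> is possible under
  \<open>safe_move\<close> only at a lost vertex.\<close>

lemma safe_strategy:
  assumes legal: "legal_strategy \<omega> \<sigma>" "legal_strategy \<omega> \<tau>"
    and move: "\<And>v. 0 < num_children \<omega> v \<Longrightarrow> safe_move \<omega> v (player \<sigma> \<tau> b v)"
    and root: "if b then \<not> lost_at \<omega> [] else \<not> won_at \<omega> []"
  shows "\<not> player_wins_play \<omega> \<sigma> \<tau> (\<not> b)"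
proof
  assume "player_wins_play \<omega> \<sigma> \<tau> (\<not> b)"
  then obtain n where "(even n \<noteq> b \<and> mover_wins_at \<omega> \<sigma> \<tau> n) \<or> (even n = b \<and> mover_loses_at \<omega> \<sigma> \<tau> n)"
    unfolding player_wins_play_def by auto
  then show False
  proof (elim disjE conjE)
    assume n: "even n \<noteq> b" "mover_wins_at \<omega> \<sigma> \<tau> n"
    then have run: "still_running \<omega> \<sigma> \<tau> n" and nc: "0 < num_children \<omega> (token \<sigma> \<tau> n)"
      and target: "label_into \<omega> (token \<sigma> \<tau> (Suc n)) = Target"
      unfolding mover_wins_at_def by auto
    have "player \<sigma> \<tau> (even n) (token \<sigma> \<tau> n) < num_children \<omega> (token \<sigma> \<tau> n)"
      using token_mem_tree[OF legal run] legal nc by (auto simp: legal_strategy_def player_def)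
    then have "won_at \<omega> (token \<sigma> \<tau> n)"
      using won_atI[of _ \<omega> "token \<sigma> \<tau> n"] target unfolding token_Suc_player by blast
    then show False
      using safe_strategy_invariant[OF legal move root run] n(1) by simp
  next
    assume n: "even n = b" "mover_loses_at \<omega> \<sigma> \<tau> n"
    then have run: "still_running \<omega> \<sigma> \<tau> n"
      and "num_children \<omega> (token \<sigma> \<tau> n) = 0 \<or> label_into \<omega> (token \<sigma> \<tau> (Suc n)) = Trap"
      unfolding mover_loses_at_def by auto
    moreover have nl: "\<not> lost_at \<omega> (token \<sigma> \<tau> n)"
      using safe_strategy_invariant[OF legal move root run] n(1) by simp
    moreover from nl have "0 < num_children \<omega> (token \<sigma> \<tau> n)"
      using lost_atI[of \<omega> "token \<sigma> \<tau> n"] by (cases "num_children \<omega> (token \<sigma> \<tau> n)") auto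
    ultimately show False
      using move[of "token \<sigma> \<tau> n"] n(1) unfolding safe_move_def token_Suc_player by auto
  qed
qed

lemma winning_strategy_exists:
  "\<exists>\<sigma>. legal_strategy \<omega> \<sigma> \<and> (\<forall>v. 0 < num_children \<omega> v \<longrightarrow> winning_move \<omega> v (\<sigma> v))"
proof -
  obtain \<sigma> where "\<forall>v. 0 < num_children \<omega> v \<longrightarrow> winning_move \<omega> v (\<sigma> v)"
    using winning_move_exists[of \<omega>] by metis
  then show ?thesis by (auto simp: legal_strategy_def winning_move_def)
qed

lemma safe_strategy_exists:
  "\<exists>\<sigma>. legal_strategy \<omega> \<sigma> \<and> (\<forall>v. 0 < num_children \<omega> v \<longrightarrow> safe_move \<omega> v (\<sigma> v))"
proof -
  obtain \<sigma> where "\<forall>v. 0 < num_children \<omega> v \<longrightarrow> safe_move \<omega> v (\<sigma> v)"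
    using safe_move_exists[of \<omega>] by metis
  then show ?thesis by (auto simp: legal_strategy_def safe_move_def)
qed

section \<open>The outcome of the game in terms of stages\<close>

text \<open>For the forward direction the given winning strategy is played against a safe strategy
  of the second player, which would prevent the win if the root were not won at some stage.\<close>

lemma game_won_iff: "game_won \<omega> \<longleftrightarrow> (\<exists>n. wins_within n \<omega>)"
proof
  assume "game_won \<omega>"
  then obtain \<sigma> where \<sigma>: "legal_strategy \<omega> \<sigma>"
    "\<And>\<tau>. legal_strategy \<omega> \<tau> \<Longrightarrow> player_wins_play \<omega> \<sigma> \<tau> True"
    unfolding game_won_def player_wins_play_simps by blast
  obtain \<tau> where \<tau>: "legal_strategy \<omega> \<tau>" "\<And>v. 0 < num_children \<omega> v \<Longrightarrow> safe_move \<omega> v (\<tau> v)"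
    using safe_strategy_exists[of \<omega>] by blast
  have "won_at \<omega> []"
    using safe_strategy[OF \<sigma>(1) \<tau>(1), of False] \<tau>(2) \<sigma>(2)[OF \<tau>(1)] by (auto simp: player_def)
  then show "\<exists>n. wins_within n \<omega>" by (simp add: won_at_def)
next
  assume "\<exists>n. wins_within n \<omega>"
  then obtain n where n: "wins_within n \<omega>" by blast
  obtain \<sigma> where \<sigma>: "legal_strategy \<omega> \<sigma>" "\<And>v. 0 < num_children \<omega> v \<Longrightarrow> winning_move \<omega> v (\<sigma> v)"
    using winning_strategy_exists[of \<omega>] by blast
  have "player_wins_play \<omega> \<sigma> \<tau> True" if "legal_strategy \<omega> \<tau>" for \<tau>
    using winning_strategy[OF \<sigma>(1) that, of True 0 n] \<sigma>(2) n
    by (auto simp: player_def still_running_def)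
  then show "game_won \<omega>" using \<sigma>(1) unfolding game_won_def player_wins_play_simps by blast
qed

lemma game_lost_iff: "game_lost \<omega> \<longleftrightarrow> (\<exists>n. loses_within n \<omega>)"
proof
  assume "game_lost \<omega>"
  then obtain \<tau> where \<tau>: "legal_strategy \<omega> \<tau>"
    "\<And>\<sigma>. legal_strategy \<omega> \<sigma> \<Longrightarrow> player_wins_play \<omega> \<sigma> \<tau> False"
    unfolding game_lost_def player_wins_play_simps by blast
  obtain \<sigma> where \<sigma>: "legal_strategy \<omega> \<sigma>" "\<And>v. 0 < num_children \<omega> v \<Longrightarrow> safe_move \<omega> v (\<sigma> v)"
    using safe_strategy_exists[of \<omega>] by blast
  have "lost_at \<omega> []"
    using safe_strategy[OF \<sigma>(1) \<tau>(1), of True] \<sigma>(2) \<tau>(2)[OF \<sigma>(1)] by (auto simp: player_def)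
  then show "\<exists>n. loses_within n \<omega>" by (simp add: lost_at_def)
next
  assume "\<exists>n. loses_within n \<omega>"
  then obtain n where n: "loses_within n \<omega>" by blast
  obtain \<tau> where \<tau>: "legal_strategy \<omega> \<tau>" "\<And>v. 0 < num_children \<omega> v \<Longrightarrow> winning_move \<omega> v (\<tau> v)"
    using winning_strategy_exists[of \<omega>] by blast
  have "player_wins_play \<omega> \<sigma> \<tau> False" if "legal_strategy \<omega> \<sigma>" for \<sigma>
    using winning_strategy[OF that \<tau>(1), of False 0 n] \<tau>(2) n
    by (auto simp: player_def still_running_def)
  then show "game_lost \<omega>" using \<tau>(1) unfolding game_lost_def player_wins_play_simps by blast
qed

section \<open>Recursion for the winning and losing probabilities\<close>

definition pgf :: "nat pmf \<Rightarrow> real \<Rightarrow> real" where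
  "pgf \<nu> x = (\<Sum>m. pmf \<nu> m * x ^ m)"

definition subrealization :: "nat \<Rightarrow> realization \<Rightarrow> realization" where
  "subrealization i \<omega> = (\<lambda>v. \<omega> (i # v))"

section \<open>Independence of the root and the subtrees\<close>

locale percolation_game =
  fixes \<nu> :: "nat pmf" and p q :: real
  assumes p_nonneg: "0 \<le> p" and q_nonneg: "0 \<le> q" and pq_le: "p + q \<le> 1"
begin

abbreviation M :: "realization measure" where
  "M \<equiv> percolation_game_measure \<nu> p q"

abbreviation vertex_law :: "(nat \<times> edge_label) pmf" where
  "vertex_law \<equiv> pair_pmf \<nu> (edge_label_pmf p q)"

sublocale prob_space M
  unfolding percolation_game_measure_def by (rule prob_space_PiM) (rule measure_pmf.prob_space_axioms)

lemma space_M [simp]: "space M = UNIV"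
  by (simp add: percolation_game_measure_def space_PiM)

lemma measurable_vertex [measurable]: "(\<lambda>\<omega>. \<omega> v) \<in> measurable M (count_space UNIV)"
proof -
  have "(\<lambda>\<omega>. \<omega> v) \<in> measurable M (measure_pmf vertex_law)"
    unfolding percolation_game_measure_def by measurable
  then show ?thesis by (simp cong: measurable_cong_sets)
qed

lemma measurable_subrealization [measurable]: "subrealization i \<in> measurable M M"
proof -
  have "(\<lambda>\<omega> v. \<omega> (i # v)) \<in> measurable M M"
    by (subst (2) percolation_game_measure_def, rule measurable_PiM_single')
      (auto cong: measurable_cong_sets)
  then show ?thesis unfolding subrealization_def .
qed

lemma distr_vertex: "distr M (measure_pmf vertex_law) (\<lambda>\<omega>. \<omega> v) = measure_pmf vertex_law"
  unfolding percolation_game_measure_def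
  by (rule distr_PiM_component) (auto intro: measure_pmf.prob_space_axioms)

text \<open>\<open>Cons i\<close> is injective, and reindexing an i.i.d. family along an injection
  preserves its law.\<close>

lemma distr_subrealization: "distr M M (subrealization i) = M"
proof -
  have "subrealization i = (\<lambda>\<omega>. \<lambda>v\<in>UNIV. \<omega> (i # v))"
    by (simp add: fun_eq_iff subrealization_def)
  then show ?thesis
    using distr_PiM_reindex[of UNIV "\<lambda>_. measure_pmf vertex_law" "Cons i" UNIV]
    by (simp add: percolation_game_measure_def measure_pmf.prob_space_axioms)
qed

lemma sets_vertex: "{\<omega>. P (\<omega> v)} \<in> sets M"
  using measurable_sets[OF measurable_vertex, of "Collect P" v] by (simp add: vimage_def)

lemma sets_subrealization: "E \<in> sets M \<Longrightarrow> {\<omega>. subrealization i \<omega> \<in> E} \<in> sets M"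
  using measurable_sets[OF measurable_subrealization, of E i] by (simp add: vimage_def)

lemma prob_vertex: "prob {\<omega>. \<omega> v \<in> A} = measure_pmf.prob vertex_law A"
proof -
  have "measure_pmf.prob vertex_law A = measure (distr M (measure_pmf vertex_law) (\<lambda>\<omega>. \<omega> v)) A"
    by (simp only: distr_vertex)
  also have "\<dots> = prob {\<omega>. \<omega> v \<in> A}"
    by (subst measure_distr) (auto simp: vimage_def cong: measurable_cong_sets)
  finally show ?thesis ..
qed

lemma prob_subrealization:
  assumes [measurable]: "E \<in> sets M"
  shows "prob {\<omega>. subrealization i \<omega> \<in> E} = prob E"
proof -
  have "prob E = measure (distr M M (subrealization i)) E"
    by (simp only: distr_subrealization)
  also have "\<dots> = prob {\<omega>. subrealization i \<omega> \<in> E}"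
    by (subst measure_distr) (auto simp: vimage_def)
  finally show ?thesis ..
qed

lemma indep_vars_vertices: "indep_vars (\<lambda>_. measure_pmf vertex_law) (\<lambda>v \<omega>. \<omega> v) UNIV"
proof (subst indep_vars_iff_distr_eq_PiM)
  show "distr M (\<Pi>\<^sub>M v\<in>UNIV. measure_pmf vertex_law) (\<lambda>\<omega>. \<lambda>v\<in>UNIV. \<omega> v) =
      (\<Pi>\<^sub>M v\<in>UNIV. distr M (measure_pmf vertex_law) (\<lambda>\<omega>. \<omega> v))"
    unfolding distr_vertex percolation_game_measure_def[symmetric]
    by (subst distr_cong[OF refl refl, of _ _ "\<lambda>\<omega>. \<omega>"]) (auto simp: fun_eq_iff distr_id2)
qed (auto cong: measurable_cong_sets)

text \<open>A partition of the vertices: index 0 is the root alone, index \<open>Suc i\<close> the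
  subtree of the conceivable child \<open>i\<close>.\<close>

definition block :: "nat \<Rightarrow> vertex set" where
  "block j = (case j of 0 \<Rightarrow> {[]} | Suc i \<Rightarrow> range (Cons i))"

lemma indep_vars_blocks:
  "indep_vars (\<lambda>j. \<Pi>\<^sub>M v\<in>block j. measure_pmf vertex_law) (\<lambda>j \<omega>. restrict \<omega> (block j)) UNIV"
proof (rule indep_vars_restrict[OF indep_vars_vertices])
  show "disjoint_family_on block UNIV"
    by (auto simp: disjoint_family_on_def block_def split: nat.splits)
qed auto

text \<open>The events depend on disjoint blocks of coordinates. Subtrees exist for all indices, so
  \<open>m\<close> is fixed independently of the number of children at the root.\<close>

lemma prob_root_and_subrealizations:
  assumes E [measurable]: "E \<in> sets M"
  shows "prob {\<omega>. \<omega> [] \<in> A \<and> (\<forall>i<m. subrealization i \<omega> \<in> E)} =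
    measure_pmf.prob vertex_law A * prob E ^ m"
proof -
  \<comment> \<open>\<open>indep_vars_blocks\<close> speaks of restricted functions, so the events
    are first stated on these; their preimages \<open>X j\<close> are the original events.\<close>
  define B where "B j = (case j of 0 \<Rightarrow> {x \<in> space (\<Pi>\<^sub>M v\<in>block j. measure_pmf vertex_law). x [] \<in> A}
    | Suc i \<Rightarrow> {x \<in> space (\<Pi>\<^sub>M v\<in>block j. measure_pmf vertex_law). (\<lambda>v. x (i # v)) \<in> E})" for j
  have B: "B j \<in> sets (\<Pi>\<^sub>M v\<in>block j. measure_pmf vertex_law)" for j
  proof (cases j)
    case 0
    then show ?thesis
      using measurable_sets[OF measurable_component_singleton[of "[]" "block 0" "\<lambda>_. measure_pmf vertex_law"], of A]
      by (simp add: B_def block_def vimage_def Int_def conj_commute)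
  next
    case (Suc i)
    have "(\<lambda>x v. x (i # v)) \<in> measurable (\<Pi>\<^sub>M v\<in>block j. measure_pmf vertex_law) M"
      unfolding percolation_game_measure_def
    proof (rule measurable_PiM_single')
      show "(\<lambda>x. x (i # v)) \<in> measurable (\<Pi>\<^sub>M v\<in>block j. measure_pmf vertex_law) (measure_pmf vertex_law)" for v
        by (rule measurable_component_singleton) (simp add: Suc block_def)
    qed auto
    from measurable_sets[OF this E] show ?thesis by (simp add: B_def Suc vimage_def Int_def conj_commute)
  qed
  define X where "X j = (\<lambda>\<omega>. restrict \<omega> (block j)) -` B j \<inter> space M" for j
  have X0: "X 0 = {\<omega>. \<omega> [] \<in> A}"
    by (auto simp: X_def B_def block_def space_PiM)
  have XS: "X (Suc i) = {\<omega>. subrealization i \<omega> \<in> E}" for i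
    by (auto simp: X_def B_def block_def space_PiM subrealization_def)
  have "{\<omega>. \<omega> [] \<in> A \<and> (\<forall>i<m. subrealization i \<omega> \<in> E)} = (\<Inter>j\<in>{..<Suc m}. X j)"
    unfolding lessThan_Suc_eq_insert_0 by (auto simp: X0 XS)
  also have "prob \<dots> = (\<Prod>j\<in>{..<Suc m}. prob (X j))"
    unfolding X_def by (rule indep_varsD[OF indep_vars_blocks]) (use B in auto)
  also have "\<dots> = prob (X 0) * (\<Prod>i<m. prob (X (Suc i)))"
    by (rule prod.lessThan_Suc_shift)
  also have "\<dots> = measure_pmf.prob vertex_law A * prob E ^ m"
    by (simp add: X0 XS prob_vertex prob_subrealization)
  finally show ?thesis .
qed

section \<open>Events over the children and their edges\<close>

abbreviation label_prob :: "edge_label set \<Rightarrow> real" where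
  "label_prob S \<equiv> measure_pmf.prob (edge_label_pmf p q) S"

lemma label_probs: "label_prob {Trap} = p" "label_prob {Target} = q" "label_prob {Safe} = 1 - p - q"
  using pmf_edge_label_pmf[OF p_nonneg q_nonneg pq_le] by (simp_all add: measure_pmf_single)

lemma countable_labels [simp]: "countable (S :: edge_label set)"
proof (rule countable_finite, rule finite_subset[of _ "{Trap, Target, Safe}"])
  show "S \<subseteq> {Trap, Target, Safe}" using edge_label.exhaust by blast
qed simp

text \<open>Meaningless for the root itself, but in \<open>subrealization i \<omega>\<close> the
  entry at \<open>[]\<close> carries the label of the edge into child \<open>i\<close>. An event of
  a subrealization thus covers the edge and the subtree together.\<close>

definition root_label :: "edge_label set \<Rightarrow> realization set" where
  "root_label S = {\<omega>. snd (\<omega> []) \<in> S}"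

lemma sets_root_label [measurable, simp]: "root_label S \<in> sets M"
  unfolding root_label_def by (rule sets_vertex)

lemma prob_root_label: "prob (root_label S) = label_prob S"
proof -
  have "prob (root_label S) = measure_pmf.prob vertex_law (UNIV \<times> S)"
    unfolding root_label_def
    by (subst prob_vertex[symmetric]) (auto intro!: arg_cong[where f = prob] simp: mem_Times_iff)
  then show ?thesis by (subst (asm) measure_pmf_prob_product) auto
qed

definition all_children :: "realization set \<Rightarrow> realization set" where
  "all_children E = {\<omega>. \<forall>i < fst (\<omega> []). subrealization i \<omega> \<in> E}"

lemma sets_all_children [measurable]:
  assumes "E \<in> sets M"
  shows "all_children E \<in> sets M"
proof -
  have "all_children E = (\<Inter>i. {\<omega>. \<not> i < fst (\<omega> [])} \<union> {\<omega>. subrealization i \<omega> \<in> E})"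
    by (auto simp: all_children_def)
  also have "\<dots> \<in> sets M"
    by (intro sets.countable_INT) (auto intro!: sets.Un sets_vertex[of "\<lambda>x. \<not> i < fst x" for i] sets_subrealization[OF assms])
  finally show ?thesis .
qed

text \<open>The event is split by the number \<open>m\<close> of children. The label set
  \<open>S\<close> is carried along because one level up it describes the edge into this
  vertex.\<close>

lemma prob_root_label_and_all_children_sums:
  assumes E [measurable]: "E \<in> sets M"
  shows "(\<lambda>m. label_prob S * (pmf \<nu> m * prob E ^ m)) sums prob (root_label S \<inter> all_children E)"
proof -
  define X where "X m = {\<omega>. \<omega> [] \<in> {m} \<times> S \<and> (\<forall>i<m. subrealization i \<omega> \<in> E)}" for m
  have sets: "range X \<subseteq> sets M"
  proof safe
    fix m
    have "X m = {\<omega>. \<omega> [] \<in> {m} \<times> S} \<inter> (\<Inter>i. if i < m then {\<omega>. subrealization i \<omega> \<in> E} else space M)"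
      by (auto simp: X_def)
    also have "\<dots> \<in> sets M"
      by (intro sets.Int sets_vertex[of "\<lambda>x. x \<in> {m} \<times> S"] sets.countable_INT) (auto intro: sets_subrealization[OF E] sets.top[of M, unfolded space_M])
    finally show "X m \<in> sets M" .
  qed
  have "(\<lambda>m. prob (X m)) sums prob (\<Union>m. X m)"
    by (rule finite_measure_UNION[OF sets]) (auto simp: disjoint_family_on_def X_def)
  moreover have "(\<Union>m. X m) = root_label S \<inter> all_children E"
    by (auto simp: X_def all_children_def mem_Times_iff root_label_def)
  moreover have "prob (X m) = label_prob S * (pmf \<nu> m * prob E ^ m)" for m
    unfolding X_def by (subst prob_root_and_subrealizations[OF E], subst measure_pmf_prob_product)
      (auto simp: measure_pmf_single)
  ultimately show ?thesis by simp
qed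

lemma prob_root_label_and_all_children:
  assumes "E \<in> sets M"
  shows "prob (root_label S \<inter> all_children E) = label_prob S * pgf \<nu> (prob E)"
proof -
  \<comment> \<open>The case \<open>S = UNIV\<close>, with label probability 1, gives summability of
    the generating series itself.\<close>
  have "summable (\<lambda>m. pmf \<nu> m * prob E ^ m)"
    using sums_summable[OF prob_root_label_and_all_children_sums[OF assms, of UNIV]]
    by (simp add: measure_pmf.prob_space[simplified])
  then show ?thesis
    unfolding pgf_def
    by (intro sums_unique2[OF prob_root_label_and_all_children_sums[OF assms]] sums_mult summable_sums)
qed

lemma prob_all_children:
  assumes "E \<in> sets M"
  shows "prob (all_children E) = pgf \<nu> (prob E)"
  using prob_root_label_and_all_children[OF assms, of UNIV]
  by (simp add: root_label_def measure_pmf.prob_space[simplified])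

lemma prob_root_label_and_not_all_children:
  assumes [measurable]: "E \<in> sets M"
  shows "prob (root_label S - all_children E) = label_prob S * prob (- all_children E)"
proof -
  have "prob (root_label S - all_children E) =
      prob (root_label S) - prob (root_label S \<inter> all_children E)"
    by (subst finite_measure_Diff') auto
  then show ?thesis
    using prob_compl[of "all_children E"]
    by (simp add: prob_root_label prob_root_label_and_all_children prob_all_children Compl_eq_Diff_UNIV right_diff_distrib)
qed

section \<open>Winning and losing events\<close>

definition win_event :: "nat \<Rightarrow> realization set" where
  "win_event n = {\<omega>. wins_within n \<omega>}"

definition loss_event :: "nat \<Rightarrow> realization set" where
  "loss_event n = {\<omega>. loses_within n \<omega>}"

text \<open>The mover fails to win iff every edge is a trap, or is safe and leads to a vertex not
  lost. Written as a set difference, this has a probability that is read off by subtraction.\<close>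

lemma win_event_Suc:
  "win_event (Suc n) =
     - all_children (root_label {Trap, Safe} - root_label {Safe} \<inter> loss_event n)"
proof -
  have "(x = Target \<or> x = Safe \<and> P) \<longleftrightarrow> \<not> ((x = Trap \<or> x = Safe) \<and> (x = Safe \<longrightarrow> \<not> P))" for x P
    by (cases x) auto
  then show ?thesis by (auto simp: win_event_def loss_event_def all_children_def subrealization_def root_label_def)
qed

lemma loss_event_Suc:
  "loss_event (Suc n) =
     all_children (root_label {Trap} \<union> root_label {Safe} \<inter> win_event n)"
  by (auto simp: win_event_def loss_event_def all_children_def subrealization_def root_label_def)

lemma sets_win_loss_event: "win_event n \<in> sets M \<and> loss_event n \<in> sets M"
proof (induction n)
  case 0
  then show ?case by (simp add: win_event_def loss_event_def)
next
  case (Suc n)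
  then have [measurable]: "win_event n \<in> sets M" "loss_event n \<in> sets M" by auto
  have "- all_children E \<in> sets M" if "E \<in> sets M" for E
    using sets.compl_sets[OF sets_all_children[OF that]] by (simp add: Compl_eq_Diff_UNIV)
  then show ?case unfolding win_event_Suc loss_event_Suc by (auto intro!: sets_all_children)
qed

lemmas sets_win_event [measurable] = sets_win_loss_event[THEN conjunct1]
  and sets_loss_event [measurable] = sets_win_loss_event[THEN conjunct2]

text \<open>Winning never consults the root label: at positive stages it is the complement of an
  \<open>all_children\<close> event, which is independent of that label.\<close>

lemma prob_safe_and_win: "prob (root_label {Safe} \<inter> win_event n) = (1 - p - q) * prob (win_event n)"
proof (cases n)
  case 0
  then show ?thesis by (simp add: win_event_def)
next
  case (Suc m)
  have "root_label {Safe} \<inter> - all_children E = root_label {Safe} - all_children E" for E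
    by blast
  then show ?thesis unfolding Suc win_event_Suc
    by (simp only:) (subst prob_root_label_and_not_all_children, auto simp: label_probs)
qed

lemma prob_safe_and_loss: "prob (root_label {Safe} \<inter> loss_event n) = (1 - p - q) * prob (loss_event n)"
proof (cases n)
  case 0
  then show ?thesis by (simp add: loss_event_def)
next
  case (Suc m)
  show ?thesis unfolding Suc loss_event_Suc
    by (subst prob_root_label_and_all_children, auto simp: label_probs prob_all_children)
qed

lemma prob_loss_event_Suc: "prob (loss_event (Suc n)) = pgf \<nu> (p + (1 - p - q) * prob (win_event n))"
proof -
  have "prob (root_label {Trap} \<union> root_label {Safe} \<inter> win_event n) =
      p + (1 - p - q) * prob (win_event n)"
  proof (subst finite_measure_Union)
    show "root_label {Trap} \<inter> (root_label {Safe} \<inter> win_event n) = {}"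
      by (auto simp: root_label_def)
  qed (simp_all add: prob_safe_and_win prob_root_label label_probs sets_win_event)
  then show ?thesis unfolding loss_event_Suc by (subst prob_all_children) auto
qed

lemma prob_win_event_Suc: "prob (win_event (Suc n)) = 1 - pgf \<nu> (p + (1 - p - q) * (1 - prob (loss_event n)))"
proof -
  let ?E = "root_label {Trap, Safe} - root_label {Safe} \<inter> loss_event n"
  have "label_prob {Trap, Safe} = label_prob {Trap} + label_prob {Safe}"
    by (subst measure_pmf.finite_measure_Union[symmetric]) (auto simp: insert_commute)
  then have "prob ?E = p + (1 - p - q) * (1 - prob (loss_event n))"
  proof (subst finite_measure_Diff)
    show "root_label {Safe} \<inter> loss_event n \<subseteq> root_label {Trap, Safe}"
      by (auto simp: root_label_def)
  qed (simp_all add: prob_safe_and_loss prob_root_label label_probs sets_loss_event algebra_simps)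
  moreover have "prob (- all_children ?E) = 1 - prob (all_children ?E)"
    using prob_compl[of "all_children ?E"] by (simp add: Compl_eq_Diff_UNIV)
  ultimately show ?thesis unfolding win_event_Suc by (simp only: prob_all_children sets_root_label sets.Diff sets.Int sets_loss_event)
qed

text \<open>The undecided events decrease to the draw event, by \<open>game_won_iff\<close> and
  \<open>game_lost_iff\<close>; the rest is continuity from above and disjointness of winning and
  losing.\<close>

lemma draw_probability_limit:
  "(\<lambda>n. 1 - prob (loss_event n) - prob (win_event n)) \<longlonglongrightarrow> draw_probability \<nu> p q"
proof -
  define D where "D n = - (win_event n \<union> loss_event n)" for n
  have D: "D n \<in> sets M" for n
    using sets.compl_sets[of "win_event n \<union> loss_event n" M] by (simp add: D_def Compl_eq_Diff_UNIV)
  have "decseq D"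
    unfolding D_def win_event_def loss_event_def decseq_def
    using wins_within_mono loses_within_mono by blast
  then have "(\<lambda>n. prob (D n)) \<longlonglongrightarrow> prob (\<Inter>n. D n)"
    using D by (intro finite_Lim_measure_decseq) auto
  moreover have "prob (D n) = 1 - prob (loss_event n) - prob (win_event n)" for n
  proof -
    have "win_event n \<inter> loss_event n = {}"
      using not_wins_and_loses_within by (auto simp: win_event_def loss_event_def)
    then have "prob (win_event n \<union> loss_event n) = prob (win_event n) + prob (loss_event n)"
      by (intro finite_measure_Union) auto
    then show ?thesis
      using prob_compl[of "win_event n \<union> loss_event n"] by (simp add: D_def Compl_eq_Diff_UNIV)
  qed
  moreover have "(\<Inter>n. D n) = {\<omega> \<in> space M. game_drawn \<omega>}"
    by (auto simp: D_def win_event_def loss_event_def game_drawn_def game_won_iff game_lost_iff)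
  ultimately show ?thesis unfolding draw_probability_def by simp
qed

lemma incseq_prob_win_event: "incseq (\<lambda>n. prob (win_event n))"
  by (rule incseq_SucI, rule finite_measure_mono)
    (auto simp only: win_event_def mem_Collect_eq sets_win_event[unfolded win_event_def]
      dest: within_Suc_mono[THEN conjunct1, rule_format])

lemma incseq_prob_loss_event: "incseq (\<lambda>n. prob (loss_event n))"
  by (rule incseq_SucI, rule finite_measure_mono)
    (auto simp only: loss_event_def mem_Collect_eq sets_loss_event[unfolded loss_event_def]
      dest: within_Suc_mono[THEN conjunct2, rule_format])

end

section \<open>Negative binomial offspring\<close>

text \<open>Newton's binomial series with exponent \<open>- r\<close> at
  \<open>- (1 - \<pi>) * x\<close>, which lies inside the unit disc because
  \<open>\<pi> > 0\<close>.\<close>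

lemma neg_binomial_pgf_sums:
  assumes "0 < \<pi>" and "\<pi> \<le> 1" and "0 \<le> x" and "x \<le> 1"
  shows "(\<lambda>m. pmf (neg_binomial_pmf r \<pi>) m * x ^ m) sums (\<pi> / (1 - (1 - \<pi>) * x)) ^ r"
proof -
  define z where "z = (1 - \<pi>) * x"
  have z: "0 \<le> z" "z < 1"
    using assms mult_mono[of "1 - \<pi>" "1 - \<pi>" x 1] by (auto simp: z_def)
  have "(\<lambda>m. \<pi> ^ r * ((- real r gchoose m) * (- z) ^ m)) sums (\<pi> ^ r * (1 + - z) powr - real r)"
    using z by (intro sums_mult gen_binomial_real) auto
  moreover have "(1 + - z) powr - real r = 1 / (1 - z) ^ r"
    using z by (simp add: powr_minus powr_realpow divide_inverse)
  moreover have "\<pi> ^ r * ((- real r gchoose m) * (- z) ^ m) = pmf (neg_binomial_pmf r \<pi>) m * x ^ m" for m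
    using assms unfolding z_def
    by (subst Probability_Mass_Function.pmf_neg_binomial')
      (auto simp: power_mult_distrib power_minus[of "(1 - \<pi>) * x"])
  ultimately show ?thesis unfolding z_def by (simp add: power_divide)
qed

lemma pgf_neg_binomial:
  assumes "0 < \<pi>" and "\<pi> \<le> 1" and "0 \<le> x" and "x \<le> 1"
  shows "pgf (neg_binomial_pmf r \<pi>) x = \<pi> ^ r / (1 - (1 - \<pi>) * x) ^ r"
  using sums_unique[OF neg_binomial_pgf_sums[OF assms, of r]] by (simp add: pgf_def power_divide)

theorem theorem1p5:
  fixes r :: nat and \<pi> p q :: real
  assumes "1 \<le> r" and "0 < \<pi>" and "\<pi> \<le> 1"
    and "p \<in> {0..1}" and "q \<in> {0..1}" and "0 < p + q" and "p + q < 1"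
  shows "draw_probability (neg_binomial_pmf r \<pi>) p q = 0 \<longleftrightarrow>
    (real r - 1) ^ (r + 1) * (1 - \<pi>) * (1 - p - q) * \<pi> ^ r
      \<le> (q + \<pi> - q * \<pi>) ^ (r + 1) * real r ^ r"
proof -
  interpret percolation_game "neg_binomial_pmf r \<pi>" p q
    using assms(4-7) by unfold_locales auto
  define s where "s = 1 - p - q"
  define A where "A = q + \<pi> - q * \<pi>"
  define K where "K = (1 - \<pi>) * s * \<pi> ^ r"
  define w where "w n = prob (win_event n)" for n
  define b where "b n = 1 - prob (loss_event n)" for n
  define Y where "Y x = 1 - (1 - \<pi>) * (p + s * x)" for x
  have s: "0 \<le> s" "p + s \<le> 1" using assms(5,7) by (auto simp: s_def)
  have "0 \<le> q * (1 - \<pi>)" using assms(3,5) by simp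
  then have A: "0 < A" using assms(2) by (simp add: A_def algebra_simps)
  have K: "0 \<le> K" using assms(2,3) s(1) by (simp add: K_def)
  have w01: "w n \<in> {0..1}" and b01: "b n \<in> {0..1}" for n by (auto simp: w_def b_def)
  \<comment> \<open>\<open>Y x\<close> is the denominator of the generating function at
    \<open>p + s * x\<close>. It is nonincreasing in \<open>x\<close>, so its least value on the
    unit interval is \<open>Y 1\<close>.\<close>
  have Y1: "Y 1 = A" by (simp add: Y_def A_def s_def algebra_simps)
  have Y_ge: "A \<le> Y x" if "x \<in> {0..1}" for x
    unfolding Y1[symmetric] Y_def using that assms(3) s(1)
    by (intro diff_left_mono mult_left_mono add_left_mono) auto
  have pgf: "pgf (neg_binomial_pmf r \<pi>) (p + s * x) = \<pi> ^ r / Y x ^ r" if "x \<in> {0..1}" for x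
  proof -
    have "0 \<le> s * x" "s * x \<le> s" using that s(1) by (auto intro: mult_left_le)
    then show ?thesis using pgf_neg_binomial[OF assms(2,3), of "p + s * x" r] s(2) assms(4)
      by (simp add: Y_def)
  qed
  have w_Suc: "w (Suc n) = 1 - \<pi> ^ r / Y (b n) ^ r" and b_Suc: "b (Suc n) = 1 - \<pi> ^ r / Y (w n) ^ r" for n
    using prob_win_event_Suc[of n] prob_loss_event_Suc[of n] pgf[OF b01] pgf[OF w01]
    by (simp_all add: w_def b_def s_def)
  have Y_step: "Y (1 - \<pi> ^ r / c) = A + K / c" for c
    
  proof -
    have "Y (1 - \<pi> ^ r / c) = 1 - (1 - \<pi>) * (p + s) + (1 - \<pi>) * s * (\<pi> ^ r / c)"
      unfolding Y_def by (simp only: algebra_simps)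
    then show ?thesis using Y1 by (simp add: Y_def K_def)
  qed
  have w0: "w 0 = 0" and b0: "b 0 = 1"
    by (auto simp: w_def b_def win_event_def loss_event_def)
  obtain W where "(\<lambda>n. prob (win_event n)) \<longlonglongrightarrow> W"
    using incseq_convergent[OF incseq_prob_win_event, of 1] by auto
  then have W: "w \<longlonglongrightarrow> W" by (simp add: w_def[abs_def])
  obtain L where "(\<lambda>n. prob (loss_event n)) \<longlonglongrightarrow> L"
    using incseq_convergent[OF incseq_prob_loss_event, of 1] by auto
  then have B: "b \<longlonglongrightarrow> 1 - L" unfolding b_def[abs_def] by (intro tendsto_intros)
  have Ylim: "(\<lambda>n. Y (f n)) \<longlonglongrightarrow> Y c" if "f \<longlonglongrightarrow> c" for f c
    unfolding Y_def by (intro tendsto_intros that)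
  have "draw_probability (neg_binomial_pmf r \<pi>) p q = (1 - L) - W"
  proof (rule LIMSEQ_unique[OF draw_probability_limit])
    show "(\<lambda>n. 1 - prob (loss_event n) - prob (win_event n)) \<longlonglongrightarrow> (1 - L) - W"
      using tendsto_diff[OF B W] by (simp add: b_def w_def)
  qed
  \<comment> \<open>For \<open>\<pi> = 1\<close> the map \<open>Y\<close> is constant, so it cannot
    simply be inverted. Instead the recursion recovers \<open>W\<close> from
    \<open>Y (1 - L)\<close> and \<open>1 - L\<close> from \<open>Y W\<close> by the same
    formula.\<close>
  moreover have "Y W = Y (1 - L) \<longleftrightarrow> 1 - L = W"
  proof
    assume eq: "Y W = Y (1 - L)"
    have "Y W \<ge> A" by (rule LIMSEQ_le_const[OF Ylim[OF W]]) (simp add: Y_ge[OF w01])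
    then have pos: "Y W > 0" using A by simp
    then have nz: "Y W ^ r \<noteq> 0" "Y (1 - L) ^ r \<noteq> 0" unfolding eq by simp_all
    have "(\<lambda>n. w (Suc n)) \<longlonglongrightarrow> 1 - \<pi> ^ r / Y (1 - L) ^ r"
      unfolding w_Suc by (intro tendsto_intros Ylim[OF B] nz)
    then have W_eq: "W = 1 - \<pi> ^ r / Y (1 - L) ^ r" by (rule LIMSEQ_unique[OF LIMSEQ_Suc[OF W]])
    have "(\<lambda>n. b (Suc n)) \<longlonglongrightarrow> 1 - \<pi> ^ r / Y W ^ r"
      unfolding b_Suc by (intro tendsto_intros Ylim[OF W] nz)
    then have "1 - L = 1 - \<pi> ^ r / Y W ^ r" by (rule LIMSEQ_unique[OF LIMSEQ_Suc[OF B]])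
    also have "\<dots> = W" unfolding eq by (rule W_eq[symmetric])
    finally show "1 - L = W" .
  qed simp
  \<comment> \<open>The sequence through \<open>b\<close> plays the role of \<open>z\<close>, since
    \<open>b 0 = 1\<close> gives the starting value \<open>A\<close>.\<close>
  moreover have "Y W = Y (1 - L) \<longleftrightarrow> (real r - 1) ^ (r + 1) * K \<le> A ^ (r + 1) * real r ^ r"
  proof (rule alternating_iteration_limits_eq_iff[OF assms(1) A K])
    show "(\<lambda>n. Y (w n)) \<longlonglongrightarrow> Y W" "(\<lambda>n. Y (b n)) \<longlonglongrightarrow> Y (1 - L)"
      by (intro Ylim W B)+
  qed (simp_all add: w_Suc b_Suc Y_step b0 Y1 Y_ge[OF w01] Y_ge[OF b01])
  ultimately have "draw_probability (neg_binomial_pmf r \<pi>) p q = 0 \<longleftrightarrow>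
      (real r - 1) ^ (r + 1) * K \<le> A ^ (r + 1) * real r ^ r" by simp
  then show ?thesis by (simp only: K_def A_def s_def mult.assoc)
qed

end
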